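(* Let $X$ be a regular Hausdorff topological space, and let $f : (0,\infty) \to X$ be a continuous map. If the limit $\lim_{n\to\infty} f(nx)$ exists in $X$ for all $x > 0$, then the limit $\lim_{x\to\infty} f(x)$ also exists in $X$.
   Context: Here $n$ ranges over $\mathbb{N}=\{1,2,\ldots\}$. A topological space $X$ is called regular if, given any closed subset $F$ of $X$ and any point $x \in X\setminus F$, there exist an open neighborhood $U$ of $x$ and an open neighborhood $V$ of $F$ which are disjoint. A space is regular Hausdorff ($T_3$) if it is both Hausdorff and regular. A sequence $\{t_n\}$ in $X$ converges to $t \in X$ if for every open neighborhood $U$ of $t$ there is $n_0\in\mathbb{N}$ with $t_n \in U$ for all $n \ge n_0$. Similarly, $\lim_{x\to\infty} f(x) = t$ means that for every open neighborhood $V$ of $t$ there is $M>0$ such that $f(x)\in V$ for all $x > M$. *)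

theory Defs
  imports "HOL-Analysis.Analysis"
begin

end

theory Submission
  imports Defs
begin

text \<open>
  The classical real-valued case is Croft's lemma, proved by Baire category.  The key point is that,
  for an open set of reals unbounded above, the generic positive \<open>x\<close> has infinitely
  many multiples in it: dilating an interval \<open>{c<..<d}\<close> of positive numbers by large
  integers produces overlapping intervals, which together cover a half-line.  By the Baire category
  theorem one \<open>x\<close> serves countably many such open sets simultaneously
  (\<open>common_point_with_frequent_multiples\<close>).

  Let \<open>a\<close> be the limit of \<open>f\<close> along the positive integers, and suppose that
  \<open>f\<close> does not tend to \<open>a\<close>; that is, \<open>f\<close> leaves some
  neighbourhood \<open>U\<close> of \<open>a\<close> at arbitrarily large arguments.  Using regularity
  twice, choose \<open>V \<subseteq> C \<subseteq> W \<subseteq> D \<subseteq> U\<close> around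
  \<open>a\<close> with \<open>V, W\<close> open and \<open>C, D\<close> closed.  The sets where
  \<open>f\<close> lies in \<open>V\<close> and where \<open>f\<close> lies outside \<open>D\<close>
  are open and unbounded, so for a single \<open>x\<close> the sequence \<open>f (n x)\<close> visits
  both \<open>V\<close> and the complement of \<open>D\<close> infinitely often.  Its limit then lies
  in the closed set \<open>C\<close> but not in the open set \<open>W\<close>, which is absurd.
  The second layer is what makes this work: with one layer only, the limit could lie on the common
  boundary of the two sets visited.
\<close>

text \<open>
  The condition on \<open>n\<close> is that it lies strictly between \<open>t / d\<close> and
  \<open>t / c\<close>, a gap whose length grows linearly in \<open>t\<close>.
\<close>

lemma eventually_in_large_multiple_of_interval:
  fixes c d :: real
  assumes "0 < c" "c < d"
  shows "\<forall>\<^sub>F t in at_top. \<exists>n\<ge>N. 0 < n \<and> t / real n \<in> {c<..<d}"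
proof -
  have gap: "1 / d < 1 / c"
    using assms by (simp add: field_simps)
  have "\<forall>\<^sub>F t in at_top. max (real N * d) (1 / (1 / c - 1 / d)) < t"
    by (rule eventually_gt_at_top)
  then show ?thesis
  proof eventually_elim
    case (elim t)
    define n where "n = Suc (nat \<lfloor>t / d\<rfloor>)"
    have t: "real N * d < t" "1 < t * (1 / c - 1 / d)"
      using elim gap by (auto simp: pos_divide_less_eq)
    have "0 \<le> real N * d"
      using assms by simp
    then have "0 < t"
      using t by linarith
    then have "0 < t / d"
      using assms by simp
    then have n: "t / d < real n" "real n \<le> t / d + 1" "0 < real n"
      unfolding n_def by linarith+
    have "real N < t / d"
      using t assms by (simp add: field_simps)
    then have "N \<le> n"
      using n by linarith
    moreover have "real n < t / c"
      using n t by (simp add: right_diff_distrib)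
    then have "c < t / real n"
      using n assms by (simp add: field_simps)
    moreover have "t / real n < d"
      using n assms by (simp add: field_simps)
    ultimately show ?case
      using n by auto
  qed
qed

text \<open>
  The half-line below \<open>1\<close> is adjoined because the multiples of a nonpositive number
  need not meet \<open>A\<close>: this makes the set dense in the whole line, so the Baire category
  theorem applies to the complete space of all reals and nothing is lost above \<open>1\<close>.
\<close>

lemma open_dense_multiples:
  fixes A :: "real set"
  assumes "open A" and unbdd: "\<exists>\<^sub>F t in at_top. t \<in> A"
  defines "G \<equiv> \<lambda>N. {..<1} \<union> {x. \<exists>n\<ge>N. real n * x \<in> A}"
  shows "open (G N)" and "closure (G N) = UNIV"
proof -
  have "open ((\<lambda>x. real n * x) -` A)" for n
    using \<open>open A\<close> by (intro open_vimage continuous_intros)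
  moreover have "G N = {..<1} \<union> (\<Union>n\<in>{N..}. (\<lambda>x. real n * x) -` A)"
    by (auto simp: G_def)
  ultimately show "open (G N)"
    by (auto simp only: intro!: open_Un open_UN open_lessThan)
  have meets: "\<exists>x\<in>G N. x \<in> {c<..<d}" if "c < d" for c d
  proof (cases "c < 1")
    case True
    then obtain x where "c < x" "x < min 1 d"
      using dense[of c "min 1 d"] \<open>c < d\<close> by auto
    then show ?thesis
      by (auto simp: G_def)
  next
    case False
    then have "\<exists>\<^sub>F t in at_top. t \<in> A \<and> (\<exists>n\<ge>N. 0 < n \<and> t / real n \<in> {c<..<d})"
      using that
      by (intro frequently_eventually_frequently unbdd eventually_in_large_multiple_of_interval) auto
    then obtain t n where tn: "t \<in> A" "n \<ge> N" "0 < n" "t / real n \<in> {c<..<d}"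
      by (auto dest: frequently_ex)
    then have "t / real n \<in> G N"
      by (auto simp: G_def intro!: exI[of _ n])
    then show ?thesis
      using tn by blast
  qed
  show "closure (G N) = UNIV"
  proof -
    have "\<exists>x\<in>G N. dist x y < e" if "0 < e" for y e
    proof -
      have "y - e < y + e"
        using that by simp
      from meets[OF this] show ?thesis
        by (auto simp: dist_real_def abs_less_iff algebra_simps intro!: bexI)
    qed
    then show ?thesis
      by (auto simp: closure_approachable)
  qed
qed

lemma common_point_with_frequent_multiples:
  fixes \<A> :: "real set set"
  assumes "countable \<A>"
    and "\<And>A. A \<in> \<A> \<Longrightarrow> open A"
    and "\<And>A. A \<in> \<A> \<Longrightarrow> \<exists>\<^sub>F t in at_top. t \<in> A"
  shows "\<exists>x>0. \<forall>A\<in>\<A>. \<exists>\<^sub>F n in sequentially. real n * x \<in> A"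
proof -
  define G where "G = (\<lambda>(A, N). {..<1} \<union> {x::real. \<exists>n\<ge>N. real n * x \<in> A})"
  let ?\<G> = "G ` (\<A> \<times> (UNIV :: nat set))"
  have "UNIV \<subseteq> closure (\<Inter>?\<G>)"
  proof (rule Baire)
    show "countable ?\<G>"
      using assms by auto
    fix T assume "T \<in> ?\<G>"
    then show "openin (top_of_set UNIV) T \<and> UNIV \<subseteq> closure T"
      using open_dense_multiples assms by (auto simp: G_def)
  qed auto
  then have "3 / 2 \<in> closure (\<Inter>?\<G>)"
    by blast
  then obtain x where "x \<in> \<Inter>?\<G>" "dist x (3 / 2) < 1 / 2"
    using closure_approachable[of "3 / 2" "\<Inter>?\<G>"] half_gt_zero[OF zero_less_one] by blast
  then have x: "1 < x" "\<And>A N. A \<in> \<A> \<Longrightarrow> x \<in> G (A, N)"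
    by (auto simp: dist_real_def abs_if split: if_splits)
  have "\<exists>n\<ge>N. real n * x \<in> A" if "A \<in> \<A>" for A N
    using x(1) x(2)[OF that, of N] by (auto simp: G_def)
  then have "\<forall>A\<in>\<A>. \<exists>\<^sub>F n in sequentially. real n * x \<in> A"
    by (simp add: frequently_sequentially)
  then show ?thesis
    using x(1) by (intro exI[of _ x]) auto
qed

theorem mainTheorem5:
  fixes X :: "'a topology" and f :: "real \<Rightarrow> 'a"
  assumes "regular_space X" and "Hausdorff_space X"
    and "continuous_map (top_of_set {0<..}) X f"
    and "\<And>x::real. x > 0 \<Longrightarrow> \<exists>l. limitin X (\<lambda>n::nat. f (real n * x)) l sequentially"
  shows "\<exists>l. limitin X f l at_top"
proof -
  have nbhd: "\<exists>V C. openin X V \<and> closedin X C \<and> a \<in> V \<and> V \<subseteq> C \<and> C \<subseteq> U"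
    if "openin X U" "a \<in> U" for U a
    using assms(1) that by (auto simp: neighbourhood_base_of_closedin[symmetric] neighbourhood_base_of)
  have open_preimage: "open {t\<in>{0<..}. f t \<in> S}" if "openin X S" for S
    using openin_continuous_map_preimage[OF assms(3) that]
    by (simp add: openin_open_eq)
  obtain a where a: "limitin X (\<lambda>n. f (real n)) a sequentially"
    using assms(4)[of 1] by auto
  have "\<forall>\<^sub>F t in at_top. f t \<in> U" if U: "openin X U" "a \<in> U" for U
  proof (rule ccontr)
    assume "\<not> ?thesis"
    then have outside: "\<exists>\<^sub>F t in at_top. f t \<notin> U"
      by (simp add: not_eventually)
    obtain W D where W: "openin X W" "closedin X D" "a \<in> W" "W \<subseteq> D" "D \<subseteq> U"
      using nbhd[OF U] by blast
    obtain V C where V: "openin X V" "closedin X C" "a \<in> V" "V \<subseteq> C" "C \<subseteq> W"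
      using nbhd[OF W(1,3)] by blast
    define A where "A = {t\<in>{0<..}. f t \<in> V}"
    define B where "B = {t\<in>{0<..}. f t \<in> topspace X - D}"
    have "open A" "open B"
      unfolding A_def B_def using V(1) W(2) by (blast intro: open_preimage)+
    have "\<exists>\<^sub>F t in at_top. t \<in> A"
    proof -
      have "\<forall>\<^sub>F n in sequentially. f (real n) \<in> V"
        using a V by (simp add: limitin_def)
      then have "\<forall>\<^sub>F n in sequentially. real n \<in> A"
        using eventually_gt_at_top[of 0] by eventually_elim (simp add: A_def)
      then have "\<exists>\<^sub>F n in sequentially. real n \<in> A"
        by (simp add: eventually_frequently)
      then show ?thesis
        unfolding frequently_def
        using eventually_compose_filterlim[OF _ filterlim_real_sequentially] by blast
    qed
    moreover have "\<exists>\<^sub>F t in at_top. t \<in> B"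
    proof -
      have "\<exists>\<^sub>F t in at_top. f t \<notin> U \<and> 0 < t"
        using outside eventually_gt_at_top by (rule frequently_eventually_frequently)
      moreover have "f t \<in> topspace X" if "0 < t" for t
        using continuous_map_image_subset_topspace[OF assms(3)] that by auto
      ultimately show ?thesis
        using W(5) by (auto simp: B_def elim: frequently_elim1)
    qed
    ultimately obtain x where x: "0 < x"
      "\<exists>\<^sub>F n in sequentially. real n * x \<in> A" "\<exists>\<^sub>F n in sequentially. real n * x \<in> B"
      using common_point_with_frequent_multiples[of "{A, B}"] \<open>open A\<close> \<open>open B\<close> by auto
    obtain l where l: "limitin X (\<lambda>n. f (real n * x)) l sequentially"
      using assms(4) x by blast
    have "l \<in> C"
    proof (rule ccontr)
      assume "l \<notin> C"
      then have "\<forall>\<^sub>F n in sequentially. f (real n * x) \<in> topspace X - C"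
        using l openin_diff[OF openin_topspace V(2)] unfolding limitin_def by blast
      then have "\<forall>\<^sub>F n in sequentially. real n * x \<notin> A"
        by eventually_elim (use V(4) in \<open>auto simp: A_def\<close>)
      then show False
        using x by (simp add: frequently_def)
    qed
    then have "\<forall>\<^sub>F n in sequentially. f (real n * x) \<in> W"
      using l V W by (auto simp: limitin_def)
    then have "\<forall>\<^sub>F n in sequentially. real n * x \<notin> B"
      by eventually_elim (use W(4) in \<open>auto simp: B_def\<close>)
    then show False
      using x by (simp add: frequently_def)
  qed
  then have "limitin X f a at_top"
    using a by (simp add: limitin_def)
  then show ?thesis ..
qed

end
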